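(* Let $r:\mathcal{Y}\to[0,r_{\max}]$ be a reward function and let $f:\mathbb{R}\to\mathbb{R}$ be monotonically increasing and $L_f$-Lipschitz continuous on $[0,1]$. For $\pi\in\mathcal{P}$ let $\mathcal{T}[\pi](y)=f\big(C[\pi](r(y))\big)\cdot\pi(y)$. Then the functional $R[\pi]=\int r(y)\,\mathcal{T}[\pi](y)\,dy$ is concave in $\pi\in\mathcal{P}$.
   Context: $\mathcal{Y}$ is the response space. $\mathcal{P}$ is the (convex) set of policies, i.e. probability distributions $\pi$ on $\mathcal{Y}$ (written as densities $\pi(y)$; dependence on a prompt variable is suppressed) for which the distribution of the reward $r(y)$, $y\sim\pi$, has a density on $[0,r_{\max}]$. The reward CDF is $C[\pi](s)=\int \mathbf{1}[r(y)\le s]\,\pi(y)\,dy$. (The case $f(z)=Nz^{N-1}$ corresponds to best-of-$N$ sampling; $\mathcal{T}[\pi]$ is not required to be normalized for general $f$.) *)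

theory Defs
  imports "HOL-Probability.Probability"
begin

(* The response space is a measure space M; its measure is the reference measure dy with
   respect to which policies are densities. *)

definition policies :: "'a measure \<Rightarrow> ('a \<Rightarrow> real) \<Rightarrow> real \<Rightarrow> ('a \<Rightarrow> real) set" where
  "policies M r rmax =
     {\<pi>. \<pi> \<in> borel_measurable M \<and> (\<forall>y\<in>space M. 0 \<le> \<pi> y) \<and>
          prob_space (density M (\<lambda>y. ennreal (\<pi> y))) \<and>
          (\<exists>p. distributed (density M (\<lambda>y. ennreal (\<pi> y))) lborel r p \<and>
               (\<forall>s. s \<notin> {0..rmax} \<longrightarrow> p s = 0))}"

definition reward_cdf :: "'a measure \<Rightarrow> ('a \<Rightarrow> real) \<Rightarrow> ('a \<Rightarrow> real) \<Rightarrow> real \<Rightarrow> real" where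
  "reward_cdf M r \<pi> s = (LINT y|M. indicator {y. r y \<le> s} y * \<pi> y)"

definition transformed ::
  "'a measure \<Rightarrow> ('a \<Rightarrow> real) \<Rightarrow> (real \<Rightarrow> real) \<Rightarrow> ('a \<Rightarrow> real) \<Rightarrow> 'a \<Rightarrow> real" where
  "transformed M r f \<pi> y = f (reward_cdf M r \<pi> (r y)) * \<pi> y"

definition reward_functional ::
  "'a measure \<Rightarrow> ('a \<Rightarrow> real) \<Rightarrow> (real \<Rightarrow> real) \<Rightarrow> ('a \<Rightarrow> real) \<Rightarrow> real" where
  "reward_functional M r f \<pi> = (LINT y|M. r y * transformed M r f \<pi> y)"

(* The function space 'a => real is not an instance of real_vector, so convex and concave_on do
   not apply to it. As with concave_on, convexity of the domain is part of the definition. *)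

definition concave_functional_on :: "('a \<Rightarrow> real) set \<Rightarrow> (('a \<Rightarrow> real) \<Rightarrow> real) \<Rightarrow> bool" where
  "concave_functional_on P R \<longleftrightarrow>
     (\<forall>\<pi>\<in>P. \<forall>\<rho>\<in>P. \<forall>u\<ge>0. \<forall>v\<ge>0. u + v = 1 \<longrightarrow>
        (\<lambda>y. u * \<pi> y + v * \<rho> y) \<in> P \<and>
        u * R \<pi> + v * R \<rho> \<le> R (\<lambda>y. u * \<pi> y + v * \<rho> y))"

end

theory Submission
  imports Defs
begin

text \<open>
  If the reward has a continuous distribution function \<open>C\<close>, then \<open>C(r(y))\<close> is uniformly
  distributed on \<open>[0,1]\<close> under \<open>\<pi>\<close>. Writing \<open>r(y)\<close> as the integral of \<open>1[t < r(y)]\<close> over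
  \<open>t \<in> [0, r\<^sub>m\<^sub>a\<^sub>x]\<close> and exchanging the integrals gives
  \<open>R[\<pi>] = \<integral> H(C[\<pi>](t)) dt\<close> with \<open>H(c) = \<integral> f(u) 1[c < u \<le> 1] du\<close>. Since \<open>f\<close> is increasing, \<open>H\<close> is
  concave on \<open>[0,1]\<close>, and \<open>C[\<pi>](t)\<close> is linear in \<open>\<pi>\<close>.
\<close>

section \<open>Tail integrals of an increasing function\<close>

definition tail_integral :: "(real \<Rightarrow> real) \<Rightarrow> real \<Rightarrow> real" where
  "tail_integral g c = (LINT u|lborel. indicator {c<..1} u * g u)"

lemma mono_bounded_unit_interval:
  fixes g :: "real \<Rightarrow> real"
  assumes "mono g" "x \<in> {0..1}"
  shows "\<bar>g x\<bar> \<le> \<bar>g 0\<bar> + \<bar>g 1\<bar>"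
  using monoD[OF assms(1), of 0 x] monoD[OF assms(1), of x 1] assms(2) by auto

lemma integrable_tail:
  fixes g :: "real \<Rightarrow> real"
  assumes "mono g" "0 \<le> c"
  shows "integrable lborel (\<lambda>u. indicator {c<..1} u * g u)"
proof (rule integrableI_bounded_set[where A = "{0..1}" and B = "\<bar>g 0\<bar> + \<bar>g 1\<bar>"])
  note borel_measurable_mono[OF assms(1), measurable]
  show "(\<lambda>u. indicator {c<..1} u * g u) \<in> borel_measurable lborel"
    by measurable
  show "AE u in lborel. u \<in> {0..1} \<longrightarrow> norm (indicator {c<..1} u * g u) \<le> \<bar>g 0\<bar> + \<bar>g 1\<bar>"
    using mono_bounded_unit_interval[OF assms(1)] by (auto simp: indicator_def)
qed (use assms(2) in \<open>auto simp: indicator_def\<close>)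

lemma borel_measurable_tail_integral:
  assumes "mono g"
  shows "tail_integral g \<in> borel_measurable borel"
proof -
  note borel_measurable_mono[OF assms, measurable]
  \<comment> \<open>Written as a conditional, the integrand is visibly measurable jointly in
    \<open>c\<close> and \<open>u\<close>, so its integral over \<open>u\<close> is measurable in
    \<open>c\<close>.\<close>
  have "(\<lambda>c. LINT u|lborel. (if c < u \<and> u \<le> 1 then g u else 0)) \<in> borel_measurable borel"
    by measurable
  also have "(\<lambda>c. LINT u|lborel. (if c < u \<and> u \<le> 1 then g u else 0)) = tail_integral g"
    unfolding tail_integral_def by (intro ext Bochner_Integration.integral_cong) auto
  finally show ?thesis .
qed

lemma abs_tail_integral_le:
  assumes "mono g" "c \<in> {0..1}"
  shows "\<bar>tail_integral g c\<bar> \<le> \<bar>g 0\<bar> + \<bar>g 1\<bar>"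
proof -
  have int: "integrable lborel (\<lambda>u. indicator {c<..1} u * g u)"
    using integrable_tail assms by auto
  have "\<bar>tail_integral g c\<bar> \<le> (LINT u|lborel. \<bar>indicator {c<..1} u * g u\<bar>)"
    unfolding tail_integral_def by (rule integral_abs_bound)
  also have "\<dots> \<le> (LINT u|lborel. indicator {0..1::real} u * (\<bar>g 0\<bar> + \<bar>g 1\<bar>))"
  proof (rule integral_mono)
    show "\<bar>indicator {c<..1} u * g u\<bar> \<le> indicator {0..1} u * (\<bar>g 0\<bar> + \<bar>g 1\<bar>)" for u
      using mono_bounded_unit_interval[OF assms(1)] assms(2) by (auto simp: indicator_def)
  qed (use int in auto)
  finally show ?thesis by simp
qed

text \<open>The integrand \<open>g u - g m\<close> changes sign at \<open>m\<close>, so its tail integral is largest from \<open>m\<close> on.\<close>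

lemma tail_integral_supergradient:
  assumes g: "mono g" and c: "c \<in> {0..1}" and m: "m \<in> {0..1}"
  shows "tail_integral g c \<le> tail_integral g m - g m * (c - m)"
proof -
  \<comment> \<open>The constant \<open>g m\<close> contributes \<open>g m * (1 - x)\<close>;
    comparing \<open>x = c\<close> with \<open>x = m\<close> leaves exactly the linear term
    \<open>g m * (c - m)\<close>.\<close>
  have int: "integrable lborel (\<lambda>u. indicator {x<..1} u * (g u - g m))"
    and eq: "(LINT u|lborel. indicator {x<..1} u * (g u - g m)) = tail_integral g x - g m * (1 - x)"
    if "x \<in> {0..1}" for x
  proof -
    have split: "(\<lambda>u. indicator {x<..1} u * (g u - g m)) =
        (\<lambda>u. indicator {x<..1} u * g u - indicator {x<..1} u * g m)"
      by (auto simp: algebra_simps)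
    have i1: "integrable lborel (\<lambda>u. indicator {x<..1} u * g u)"
      using integrable_tail[OF g] that by auto
    have i2: "integrable lborel (\<lambda>u. indicator {x<..1} u * g m)"
      using that by auto
    show "integrable lborel (\<lambda>u. indicator {x<..1} u * (g u - g m))"
      unfolding split by (intro Bochner_Integration.integrable_diff i1 i2)
    show "(LINT u|lborel. indicator {x<..1} u * (g u - g m)) = tail_integral g x - g m * (1 - x)"
      unfolding split Bochner_Integration.integral_diff[OF i1 i2] tail_integral_def using that by simp
  qed
  have "(LINT u|lborel. indicator {c<..1} u * (g u - g m))
      \<le> (LINT u|lborel. indicator {m<..1} u * (g u - g m))"
  proof (rule integral_mono[OF int[OF c] int[OF m]])
    show "indicator {c<..1} u * (g u - g m) \<le> indicator {m<..1} u * (g u - g m)" for u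
      using monoD[OF g, of u m] monoD[OF g, of m u] by (auto simp: indicator_def)
  qed
  then show ?thesis
    unfolding eq[OF c] eq[OF m] by (simp add: algebra_simps)
qed

text \<open>The slope \<open>- g m\<close> is a supergradient at every \<open>m\<close> in the unit
  interval. Taking \<open>m\<close> to be the convex combination of \<open>c\<close> and
  \<open>d\<close> and averaging the two supergradient inequalities with weights \<open>u\<close>
  and \<open>v\<close> cancels the linear terms.\<close>

lemma concave_on_tail_integral:
  assumes "mono g"
  shows "concave_on {0..1} (tail_integral g)"
  unfolding concave_on_iff
proof (intro conjI ballI allI impI)
  fix c d u v :: real
  assume c: "c \<in> {0..1}" and d: "d \<in> {0..1}" and u: "0 \<le> u" and v: "0 \<le> v" and uv: "u + v = 1"
  define m where "m = u * c + v * d"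
  have m: "m \<in> {0..1}"
    using convexD[OF convex_real_interval(5) c d u v uv] by (simp add: m_def)
  have "u * tail_integral g c + v * tail_integral g d
      \<le> u * (tail_integral g m - g m * (c - m)) + v * (tail_integral g m - g m * (d - m))"
    by (intro add_mono mult_left_mono tail_integral_supergradient assms c d m u v)
  also have "\<dots> = (u + v) * tail_integral g m - g m * (u * c + v * d - (u + v) * m)"
    by (simp add: algebra_simps)
  also have "\<dots> = tail_integral g m"
    unfolding uv by (simp add: m_def)
  finally show "u * tail_integral g c + v * tail_integral g d \<le> tail_integral g (u *\<^sub>R c + v *\<^sub>R d)"
    by (simp add: m_def)
qed simp

section \<open>Real distributions with a continuous CDF\<close>

context real_distribution
begin

lemma borel_measurable_cdf [measurable]: "cdf M \<in> borel_measurable borel"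
  by (intro borel_measurable_mono monoI cdf_nondecreasing)

lemma cdf_in_unit_interval: "cdf M x \<in> {0..1}"
  using cdf_nonneg cdf_bounded_prob by auto

text \<open>Intermediate value theorem between the limits 0 at minus infinity and 1 at infinity. The
  levels 0 and 1 are excluded because they may be approached without being reached.\<close>

lemma cdf_attains:
  assumes cont: "\<And>x. isCont (cdf M) x" and u: "0 < u" "u < 1"
  obtains a where "cdf M a = u"
proof -
  have "eventually (\<lambda>x. cdf M x < u) at_bot"
    using cdf_lim_at_bot u by (intro order_tendstoD)
  then obtain x where x: "cdf M x < u"
    by (meson eventually_happens trivial_limit_at_bot_linorder)
  have "eventually (\<lambda>x. u < cdf M x) at_top"
    using cdf_lim_at_top_prob u by (intro order_tendstoD)
  then obtain y where y: "u < cdf M y"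
    by (meson eventually_happens trivial_limit_at_top_linorder)
  have "x \<le> y"
    using x y cdf_nondecreasing[of y x] by linarith
  then have "\<exists>a. x \<le> a \<and> a \<le> y \<and> cdf M a = u"
    using x y cont by (intro IVT) auto
  then show ?thesis using that by auto
qed

text \<open>For \<open>0 < u < 1\<close> the sublevel set contains a half-line \<open>{..a}\<close>
  with CDF value \<open>u\<close>, and for every level \<open>w\<close> strictly between
  \<open>u\<close> and 1 it lies in a half-line \<open>{..b}\<close> with CDF value
  \<open>w\<close>.\<close>

lemma prob_cdf_le:
  assumes cont: "\<And>x. isCont (cdf M) x" and u: "u \<in> {0..1}"
  shows "prob {x. cdf M x \<le> u} = u"
proof (rule antisym)
  show "prob {x. cdf M x \<le> u} \<le> u"
  \<comment> \<open>The CDF may be flat at level \<open>u\<close>, so the sublevel set can reach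
    beyond a point where \<open>u\<close> is attained; a strictly larger level \<open>w\<close>
    bounds it, and \<open>w\<close> may then decrease to \<open>u\<close>.\<close>
  proof (rule dense_ge)
    fix w assume w: "u < w"
    show "prob {x. cdf M x \<le> u} \<le> w"
    proof (cases "w < 1")
      case True
      obtain b where b: "cdf M b = w"
        using cdf_attains[OF cont, of w] True w u by auto
      have "{x. cdf M x \<le> u} \<subseteq> {..b}"
        proof
        fix x assume "x \<in> {x. cdf M x \<le> u}"
        then show "x \<in> {..b}"
          using cdf_nondecreasing[of b x] w b by (cases "b \<le> x") auto
      qed
      then have "prob {x. cdf M x \<le> u} \<le> prob {..b}"
        by (intro finite_measure_mono) auto
      then show ?thesis using b by (simp add: cdf_def)
    next
      case False
      then show ?thesis using prob_le_1[of "{x. cdf M x \<le> u}"] by linarith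
    qed
  qed
  show "u \<le> prob {x. cdf M x \<le> u}"
  proof -
    consider "u = 0" | "u = 1" | "0 < u" "u < 1" using u by force
    then show ?thesis
    proof cases
      case 1
      then show ?thesis by simp
    next
      case 2
      then have "{x. cdf M x \<le> u} = space M" using cdf_bounded_prob by auto
      then show ?thesis using 2 prob_space by simp
    next
      case 3
      then obtain a where a: "cdf M a = u"
        using cdf_attains[OF cont] by metis
      have "prob {..a} \<le> prob {x. cdf M x \<le> u}"
        using a cdf_nondecreasing by (intro finite_measure_mono) auto
      then show ?thesis using a by (simp add: cdf_def)
    qed
  qed
qed

text \<open>The probability integral transform. The divisor in the density is the length 1 of the
  unit interval.\<close>

lemma cdf_uniformly_distributed:
  assumes cont: "\<And>x. isCont (cdf M) x"
  shows "distributed M lborel (cdf M) (\<lambda>x. indicator {0..1::real} x / measure lborel {0..1::real})"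
proof (rule uniform_distrI_borel_atLeastAtMost)
  show "\<P>(x in M. cdf M x \<le> t) = (t - 0) / (1 - 0)" if "0 \<le> t" "t \<le> 1" for t :: real
    using prob_cdf_le[OF cont] that by simp
qed auto

text \<open>Up to a null set, \<open>t < x\<close> can be replaced by
  \<open>cdf M t < cdf M x\<close>. The integrand is then a function of \<open>cdf M x\<close>
  alone, which is uniform on the unit interval.\<close>

lemma expectation_tail:
  assumes cont: "\<And>x. isCont (cdf M) x" and g: "mono g"
  shows "(LINT x|M. (if t < x then g (cdf M x) else 0)) = tail_integral g (cdf M t)"
proof -
  note borel_measurable_mono[OF g, measurable]
  let ?k = "\<lambda>u. indicator {cdf M t<..1} u * g u"
  \<comment> \<open>These are the points beyond \<open>t\<close> at which the CDF has not yet risen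
    above its value at \<open>t\<close>; both sets in the difference have probability
    \<open>cdf M t\<close>.\<close>
  have null: "prob ({x. cdf M x \<le> cdf M t} - {..t}) = 0"
  proof (subst finite_measure_Diff)
    show "{..t} \<subseteq> {x. cdf M x \<le> cdf M t}" using cdf_nondecreasing by auto
    show "prob {x. cdf M x \<le> cdf M t} - prob {..t} = 0"
      using prob_cdf_le[OF cont cdf_in_unit_interval] by (simp add: cdf_def)
  qed auto
  have "AE x in M. x \<notin> {x. cdf M x \<le> cdf M t} - {..t}"
    using null by (intro AE_not_in) (auto simp: null_sets_def emeasure_eq_measure)
  then have ae: "AE x in M. (if t < x then g (cdf M x) else 0) = ?k (cdf M x)"
  proof eventually_elim
    case (elim x)
    then show ?case
      using cdf_nondecreasing[of x t] cdf_bounded_prob[of x] by (auto simp: not_le indicator_def)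
  qed
  have "(LINT x|M. (if t < x then g (cdf M x) else 0)) = (LINT x|M. ?k (cdf M x))"
    by (rule integral_cong_AE[OF _ _ ae]) measurable
  also have "\<dots> = (LINT u|lborel. indicator {0..1} u / measure lborel {0..1::real} * ?k u)"
    by (rule distributed_integral[OF cdf_uniformly_distributed[OF cont], symmetric]) auto
  also have "\<dots> = tail_integral g (cdf M t)"
    unfolding tail_integral_def using cdf_in_unit_interval[of t]
    by (intro Bochner_Integration.integral_cong) (auto simp: indicator_def)
  finally show ?thesis .
qed

lemma expectation_times_cdf:
  assumes cont: "\<And>x. isCont (cdf M) x" and g: "mono g" and supp: "AE x in M. x \<in> {0..b}"
  shows "(LINT x|M. x * g (cdf M x)) = (LINT t|lborel. indicator {0..b} t * tail_integral g (cdf M t))"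
proof -
  note borel_measurable_mono[OF g, measurable]
  \<comment> \<open>Layer-cake kernel: integrating over \<open>t\<close> restores the factor
    \<open>x\<close>, integrating over \<open>x\<close> gives the tail integral. The cut-off to
    \<open>{0..b}\<close> confines \<open>k\<close> to a set of finite measure, where it is bounded,
    so Fubini applies.\<close>
  define k where "k x t = indicator {0..b} t * (if t < x then g (cdf M x) else 0)" for x t :: real
  interpret pair_sigma_finite M lborel ..
  have k_meas: "case_prod k \<in> borel_measurable (M \<Otimes>\<^sub>M lborel)"
    unfolding k_def by measurable
  have int: "integrable (M \<Otimes>\<^sub>M lborel) (case_prod k)"
  proof (rule integrableI_bounded_set[where A = "space M \<times> {0..b}" and B = "\<bar>g 0\<bar> + \<bar>g 1\<bar>"])
    show "space M \<times> {0..b} \<in> sets (M \<Otimes>\<^sub>M lborel)" by (intro pair_measureI sets.top) auto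
    show "emeasure (M \<Otimes>\<^sub>M lborel) (space M \<times> {0..b}) < \<infinity>"
      by (subst lborel.emeasure_pair_measure_Times)
         (auto simp: emeasure_space_1[simplified] emeasure_lborel_Icc_eq)
    show "AE z in M \<Otimes>\<^sub>M lborel. z \<in> space M \<times> {0..b} \<longrightarrow> norm (case_prod k z) \<le> \<bar>g 0\<bar> + \<bar>g 1\<bar>"
      using mono_bounded_unit_interval[OF g cdf_in_unit_interval]
      by (intro AE_I2) (auto simp: k_def indicator_def)
    show "AE z in M \<Otimes>\<^sub>M lborel. z \<notin> space M \<times> {0..b} \<longrightarrow> case_prod k z = 0"
      by (intro AE_I2) (auto simp: k_def indicator_def)
  qed (rule k_meas)
  have "(LINT x|M. x * g (cdf M x)) = (LINT x|M. (LINT t|lborel. k x t))"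
  proof (rule integral_cong_AE)
    show "(\<lambda>x. LINT t|lborel. k x t) \<in> borel_measurable M"
      using k_meas by (rule lborel.borel_measurable_lebesgue_integral)
    show "AE x in M. x * g (cdf M x) = (LINT t|lborel. k x t)"
      using supp
    proof eventually_elim
      case (elim x)
      \<comment> \<open>Since \<open>0 \<le> x \<le> b\<close>, the contributing \<open>t\<close>
        form an interval of length \<open>x\<close>.\<close>
      have "(LINT t|lborel. k x t) = (LINT t|lborel. indicator {0..<x} t * g (cdf M x))"
        using elim by (intro Bochner_Integration.integral_cong) (auto simp: k_def indicator_def)
      then show ?case using elim by simp
    qed
  qed measurable
  also have "\<dots> = (LINT t|lborel. (LINT x|M. k x t))"
    by (rule Fubini_integral[OF int, symmetric])
  also have "\<dots> = (LINT t|lborel. indicator {0..b} t * tail_integral g (cdf M t))"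
    by (simp add: k_def expectation_tail[OF cont g])
  finally show ?thesis .
qed

end

section \<open>Policies and the laws of their rewards\<close>

lemma reward_distribution:
  assumes r: "r \<in> borel_measurable M" and range: "r \<in> space M \<rightarrow> {0..rmax}"
    and pol: "\<pi> \<in> policies M r rmax"
  defines "N \<equiv> distr (density M (\<lambda>y. ennreal (\<pi> y))) borel r"
  shows "real_distribution N" "\<And>x. isCont (cdf N) x" "AE x in N. x \<in> {0..rmax}"
    "reward_cdf M r \<pi> = cdf N"
    "integrable M \<pi>"
    "\<And>f g. (\<And>x. x \<in> {0..1} \<Longrightarrow> f x = g x) \<Longrightarrow> mono g \<Longrightarrow>
      reward_functional M r f \<pi> = (LINT x|N. x * g (cdf N x))"
proof -
  let ?D = "density M (\<lambda>y. ennreal (\<pi> y))"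
  note [measurable] = r
  from pol have [measurable]: "\<pi> \<in> borel_measurable M" and nn: "\<And>y. y \<in> space M \<Longrightarrow> 0 \<le> \<pi> y"
    and ps: "prob_space ?D" and "\<exists>p. distributed ?D lborel r p"
    unfolding policies_def by auto
  then obtain p where "distributed ?D lborel r p" by auto
  then have p: "distr ?D lborel r = density lborel p" and [measurable]: "p \<in> borel_measurable borel"
    unfolding distributed_def by auto
  have N: "N = density lborel p"
    unfolding N_def p[symmetric] by (intro distr_cong) auto
  interpret D: prob_space ?D by fact
  show rd: "real_distribution N"
    unfolding N_def by (intro D.real_distribution_distr) auto
  interpret N: real_distribution N by fact
  \<comment> \<open>The reward law has a Lebesgue density, hence no atoms, which is what makes its
    CDF continuous.\<close>
  have "{x} \<in> null_sets N" for x
    unfolding N proof (subst null_sets_density_iff, simp, intro conjI)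
    show "AE y in lborel. y \<in> {x} \<longrightarrow> p y = 0"
      using AE_lborel_singleton[of x] by eventually_elim simp
  qed simp
  then show "isCont (cdf N) x" for x
    by (simp add: N.isCont_cdf null_sets_def measure_def)
  show "AE x in N. x \<in> {0..rmax}"
    unfolding N_def using range by (subst AE_distr_iff) (auto intro!: AE_I2)
  have "integrable ?D (\<lambda>_. 1 :: real)" by simp
  then show int: "integrable M \<pi>"
    using nn by (subst (asm) integrable_density) auto
  have to_N: "(LINT y|?D. h (r y)) = (LINT x|N. h x)" if "h \<in> borel_measurable borel"
    for h :: "real \<Rightarrow> real"
    unfolding N_def using that by (intro integral_distr[symmetric]) auto
  show "reward_cdf M r \<pi> = cdf N"
  proof
    fix s
    have "reward_cdf M r \<pi> s = (LINT y|M. \<pi> y *\<^sub>R (indicator {..s} (r y) :: real))"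
      unfolding reward_cdf_def by (intro Bochner_Integration.integral_cong) (auto simp: indicator_def)
    also have "\<dots> = (LINT y|?D. indicator {..s} (r y))"
      using nn by (intro integral_density[symmetric]) auto
    also have "\<dots> = (LINT x|N. indicator {..s} x)"
      by (rule to_N) auto
    also have "\<dots> = cdf N s" by (simp add: cdf_def)
    finally show "reward_cdf M r \<pi> s = cdf N s" .
  qed
  show "reward_functional M r f \<pi> = (LINT x|N. x * g (cdf N x))"
    if fg: "\<And>x. x \<in> {0..1} \<Longrightarrow> f x = g x" and g: "mono g" for f g
  proof -
    note borel_measurable_mono[OF g, measurable]
    \<comment> \<open>CDF values lie in the unit interval, where \<open>f\<close> and
      \<open>g\<close> agree. The integrand is therefore \<open>\<pi> y\<close> times a function of
      \<open>r y\<close>, so the functional depends on the policy only through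
      \<open>N\<close>.\<close>
    have "reward_functional M r f \<pi> = (LINT y|M. \<pi> y *\<^sub>R (r y * g (cdf N (r y))))"
      unfolding reward_functional_def transformed_def \<open>reward_cdf M r \<pi> = cdf N\<close>
      using fg[OF N.cdf_in_unit_interval]
      by (intro Bochner_Integration.integral_cong) auto
    also have "\<dots> = (LINT y|?D. r y * g (cdf N (r y)))"
      using nn by (intro integral_density[symmetric]) auto
    also have "\<dots> = (LINT x|N. x * g (cdf N x))"
      by (rule to_N) measurable
    finally show ?thesis .
  qed
qed

text \<open>Mixing densities mixes the measures they define, and pushing forward along
  \<open>r\<close> preserves this. Hence \<open>u * p + v * q\<close> is a density of the mixed
  reward law, and it vanishes wherever both \<open>p\<close> and \<open>q\<close> do.\<close>

lemma policies_convex: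
  assumes r: "r \<in> borel_measurable M"
    and \<pi>: "\<pi> \<in> policies M r rmax" and \<rho>: "\<rho> \<in> policies M r rmax"
    and u: "0 \<le> u" and v: "0 \<le> v" and uv: "u + v = 1"
  shows "(\<lambda>y. u * \<pi> y + v * \<rho> y) \<in> policies M r rmax"
proof -
  let ?D = "\<lambda>\<pi>. density M (\<lambda>y. ennreal (\<pi> y))"
  let ?\<sigma> = "\<lambda>y. u * \<pi> y + v * \<rho> y"
  note [measurable] = r
  from \<pi> obtain p where [measurable]: "\<pi> \<in> borel_measurable M" and \<pi>0: "\<And>y. y \<in> space M \<Longrightarrow> 0 \<le> \<pi> y"
    and \<pi>1: "prob_space (?D \<pi>)" and p: "distributed (?D \<pi>) lborel r p" and p0: "\<And>s. s \<notin> {0..rmax} \<Longrightarrow> p s = 0"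
    unfolding policies_def by auto
  from \<rho> obtain q where [measurable]: "\<rho> \<in> borel_measurable M" and \<rho>0: "\<And>y. y \<in> space M \<Longrightarrow> 0 \<le> \<rho> y"
    and \<rho>1: "prob_space (?D \<rho>)" and q: "distributed (?D \<rho>) lborel r q" and q0: "\<And>s. s \<notin> {0..rmax} \<Longrightarrow> q s = 0"
    unfolding policies_def by auto
  have [measurable]: "p \<in> borel_measurable borel" "q \<in> borel_measurable borel"
    using p q by (auto simp: distributed_def)
  have mix: "emeasure (?D ?\<sigma>) A = ennreal u * emeasure (?D \<pi>) A + ennreal v * emeasure (?D \<rho>) A"
    if [measurable]: "A \<in> sets M" for A
  proof -
    have "emeasure (?D ?\<sigma>) A = (\<integral>\<^sup>+y. ennreal u * (ennreal (\<pi> y) * indicator A y) + ennreal v * (ennreal (\<rho> y) * indicator A y) \<partial>M)"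
      using \<pi>0 \<rho>0 u v
      by (subst emeasure_density) (auto intro!: nn_integral_cong simp: ennreal_mult ennreal_plus indicator_def)
    then show ?thesis
      by (simp add: nn_integral_add nn_integral_cmult emeasure_density)
  qed
  let ?s = "\<lambda>s. ennreal u * p s + ennreal v * q s"
  have "distributed (?D ?\<sigma>) lborel r ?s"
    unfolding distributed_def
  proof (intro conjI measure_eqI)
    fix A assume "A \<in> sets (distr (?D ?\<sigma>) lborel r)"
    then have [measurable]: "A \<in> sets borel" by simp
    have pA: "emeasure (?D \<pi>) (r -` A \<inter> space M) = (\<integral>\<^sup>+x. p x * indicator A x \<partial>lborel)"
      using distributed_emeasure[OF p, of A] by simp
    have qA: "emeasure (?D \<rho>) (r -` A \<inter> space M) = (\<integral>\<^sup>+x. q x * indicator A x \<partial>lborel)"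
      using distributed_emeasure[OF q, of A] by simp
    have "emeasure (distr (?D ?\<sigma>) lborel r) A = emeasure (?D ?\<sigma>) (r -` A \<inter> space M)"
      by (subst emeasure_distr) auto
    also have "\<dots> = ennreal u * (\<integral>\<^sup>+x. p x * indicator A x \<partial>lborel) + ennreal v * (\<integral>\<^sup>+x. q x * indicator A x \<partial>lborel)"
      by (subst mix) (simp_all only: pA qA, measurable)
    also have "\<dots> = emeasure (density lborel ?s) A"
      by (simp add: emeasure_density nn_integral_add nn_integral_cmult distrib_right mult.assoc)
    finally show "emeasure (distr (?D ?\<sigma>) lborel r) A = emeasure (density lborel ?s) A" .
  qed auto
  moreover have "prob_space (?D ?\<sigma>)"
  proof (rule prob_spaceI)
    have "emeasure (?D \<pi>) (space M) = 1" "emeasure (?D \<rho>) (space M) = 1"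
      using prob_space.emeasure_space_1[OF \<pi>1] prob_space.emeasure_space_1[OF \<rho>1] by auto
    then show "emeasure (?D ?\<sigma>) (space (?D ?\<sigma>)) = 1"
      using mix[of "space M"] u v uv by (simp flip: ennreal_plus)
  qed
  ultimately show ?thesis
    unfolding policies_def using \<pi>0 \<rho>0 u v p0 q0 by (auto intro!: exI[of _ ?s])
qed

section \<open>Concavity of the reward functional\<close>

theorem lemma5p4:
  fixes M :: "'a measure" and r :: "'a \<Rightarrow> real" and rmax :: real
    and f :: "real \<Rightarrow> real" and L\<^sub>f :: real
  assumes "r \<in> borel_measurable M"
    and "\<And>y. y \<in> space M \<Longrightarrow> r y \<in> {0..rmax}"
    and "mono_on {0..1} f"
    and "L\<^sub>f-lipschitz_on {0..1} f"
  shows "concave_functional_on (policies M r rmax) (reward_functional M r f)"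
proof -
  have range: "r \<in> space M \<rightarrow> {0..rmax}"
    using assms(2) by blast
  \<comment> \<open>Clamping the argument to the unit interval extends the restriction of
    \<open>f\<close> to a function that is increasing on the whole line, and so Borel measurable,
    without changing it at CDF values.\<close>
  define g where "g x = f (max 0 (min 1 x))" for x
  have g: "mono g"
    unfolding g_def by (intro monoI mono_onD[OF assms(3)]) auto
  have fg: "f x = g x" if "x \<in> {0..1}" for x
    using that by (simp add: g_def)
  let ?R = "\<lambda>\<pi>. reward_functional M r f \<pi>"
  let ?C = "reward_cdf M r"
  let ?h = "\<lambda>\<pi> t. indicator {0..rmax} t * tail_integral g (?C \<pi> t)"
  note [measurable] = assms(1) borel_measurable_tail_integral[OF g]
  have unit: "?C \<pi> t \<in> {0..1}" and R: "?R \<pi> = (LINT t|lborel. ?h \<pi> t)"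
    and int: "integrable lborel (?h \<pi>)" if \<pi>: "\<pi> \<in> policies M r rmax" for \<pi> t
  proof -
    define N where "N = distr (density M (\<lambda>y. ennreal (\<pi> y))) borel r"
    note N = reward_distribution[OF assms(1) range \<pi>, folded N_def]
    interpret N: real_distribution N by (rule N(1))
    show "?C \<pi> t \<in> {0..1}"
      using N.cdf_in_unit_interval by (simp add: N(4))
    show "?R \<pi> = (LINT t|lborel. ?h \<pi> t)"
      using N.expectation_times_cdf[OF N(2) g N(3)] N(6)[OF fg g] by (simp add: N(4))
    show "integrable lborel (?h \<pi>)"
      unfolding N(4)
    proof (rule integrableI_bounded_set[where A = "{0..rmax}" and B = "\<bar>g 0\<bar> + \<bar>g 1\<bar>"])
      show "AE t in lborel. t \<in> {0..rmax} \<longrightarrow>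
          norm (indicator {0..rmax} t * tail_integral g (cdf N t)) \<le> \<bar>g 0\<bar> + \<bar>g 1\<bar>"
        using abs_tail_integral_le[OF g N.cdf_in_unit_interval] by auto
    qed (auto simp: emeasure_lborel_Icc_eq)
  qed
  show ?thesis
    unfolding concave_functional_on_def
  proof (intro ballI allI impI conjI)
    fix \<pi> \<rho> and u v :: real
    assume \<pi>: "\<pi> \<in> policies M r rmax" and \<rho>: "\<rho> \<in> policies M r rmax"
      and u: "0 \<le> u" and v: "0 \<le> v" and uv: "u + v = 1"
    let ?\<sigma> = "\<lambda>y. u * \<pi> y + v * \<rho> y"
    show \<sigma>: "?\<sigma> \<in> policies M r rmax"
      using policies_convex[OF assms(1) \<pi> \<rho> u v uv] .
    \<comment> \<open>Linearity of the CDF in the policy; both summands must be integrable for the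
      integral to split.\<close>
    have C: "?C ?\<sigma> t = u * ?C \<pi> t + v * ?C \<rho> t" for t
    proof -
      have i: "integrable M (\<lambda>y. indicator {y. r y \<le> t} y * \<tau> y)" if "\<tau> \<in> policies M r rmax" for \<tau>
      proof -
        \<comment> \<open>Intersecting with \<open>space M\<close> gives a measurable set and leaves
          the integrand unchanged on the space.\<close>
        have "integrable M (\<lambda>y. indicator {y \<in> space M. r y \<le> t} y *\<^sub>R \<tau> y)"
          by (intro integrable_mult_indicator reward_distribution(5)[OF assms(1) range that]) auto
        then show ?thesis
          by (rule Bochner_Integration.integrable_cong[THEN iffD1, rotated -1]) (auto simp: indicator_def)
      qed
      have "?C ?\<sigma> t = (LINT y|M. u * (indicator {y. r y \<le> t} y * \<pi> y) + v * (indicator {y. r y \<le> t} y * \<rho> y))"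
        unfolding reward_cdf_def by (simp add: algebra_simps)
      then show ?thesis
        unfolding reward_cdf_def using i[OF \<pi>] i[OF \<rho>] by simp
    qed
    have "u * ?R \<pi> + v * ?R \<rho> = (LINT t|lborel. u * ?h \<pi> t + v * ?h \<rho> t)"
      using int[OF \<pi>] int[OF \<rho>] by (simp add: R \<pi> \<rho>)
    also have "\<dots> \<le> (LINT t|lborel. ?h ?\<sigma> t)"
    proof (rule integral_mono)
      fix t
      \<comment> \<open>For each fixed \<open>t\<close> the mixture's CDF value is the convex
        combination of the other two, so concavity of the tail integral applies pointwise;
        integrating over \<open>t\<close> transfers it to the functional.\<close>
      have "u * tail_integral g (?C \<pi> t) + v * tail_integral g (?C \<rho> t) \<le> tail_integral g (?C ?\<sigma> t)"
        using concave_on_tail_integral[OF g] unit[OF \<pi>] unit[OF \<rho>] u v uv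
        unfolding concave_on_iff C by auto
      then show "u * ?h \<pi> t + v * ?h \<rho> t \<le> ?h ?\<sigma> t"
        by (simp add: indicator_def)
    qed (use int[OF \<pi>] int[OF \<rho>] int[OF \<sigma>] in auto)
    finally show "u * ?R \<pi> + v * ?R \<rho> \<le> ?R ?\<sigma>"
      by (simp add: R \<sigma>)
  qed
qed

end
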